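(* Suppose the problem $\min_{x\in V}\{f(x):\mathcal{A}(x)=b,\ x\in\mathcal{K}\}$ with $b=\mathcal{A}(x^\natural)$ is $(\mu,r,\ell)$-sharp around $x^\natural$. Let $\mathcal{U}$ be a normed Euclidean space, let $\mathcal{B}:V\to\mathcal{U}$ be a linear operator with $r\|\mathcal{B}\|<\mu$, and let $\delta\in\mathcal{U}$. Here $\|\mathcal{B}\|$ is the operator norm induced by the norms on $V$ and $\mathcal{U}$. Then the function $$x\mapsto F_{r,\ell}(x)+r\|\mathcal{B}(x)-\mathcal{B}(x^\natural)-\delta\|$$ is $(\mu-r\|\mathcal{B}\|)$-sharp around $x^\natural$.
   Context: $V$ and $W$ are Euclidean spaces each equipped with a norm (not necessarily the Euclidean one); $\|\cdot\|$ denotes the norm of the space its argument lies in. $\mathcal{A}:V\to W$ is linear, $x^\natural\in V$, $f:V\to\mathbb{R}$ is convex, $\mathcal{K}\subseteq V$ is a closed convex cone (possibly all of $V$). For a closed nonempty set $\mathcal{X}\subseteq V$, $\operatorname{dist}(x,\mathcal{X})=\min_{y\in\mathcal{X}}\|x-y\|$ in the norm of $V$. $F_{r,\ell}(x):=f(x)+r\|\mathcal{A}(x)-b\|+\ell\operatorname{dist}(x,\mathcal{K})$. A convex $F:V\to\mathbb{R}$ is $\mu$-sharp ($\mu>0$) around a nonempty convex set $\mathcal{X}$ if $\mathcal{X}=\arg\min F$ and $F(\bar x)-\min F\ge\mu\operatorname{dist}(\bar x,\mathcal{X})$ for all $\bar x\in V$; sharp around $x^\natural$ means sharp around $\{x^\natural\}$.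 For $\mu>0$ and $r,\ell\ge0$, the problem $\min_{x\in V}\{f(x):\mathcal{A}(x)=b,\ x\in\mathcal{K}\}$ is $(\mu,r,\ell)$-sharp around $x^\natural$ if $x^\natural$ is feasible and $F_{r,\ell}$ is $\mu$-sharp around $x^\natural$. *)

theory Defs
  imports "HOL-Analysis.Analysis"
begin

text \<open>
  The norm of a \<open>euclidean_space\<close> type is fixed by its type class to be the Euclidean one, so
  an arbitrary norm on such a space is a function \<open>N\<close> satisfying the norm axioms. All norms
  on a finite-dimensional space induce the same topology; therefore the library's
  \<^const>\<open>closed\<close> is closedness with respect to any such \<open>N\<close>.
\<close>

definition is_norm :: "('a::real_vector \<Rightarrow> real) \<Rightarrow> bool" where
  "is_norm N \<longleftrightarrow>
     (\<forall>x. N x = 0 \<longleftrightarrow> x = 0) \<and>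
     (\<forall>x y. N (x + y) \<le> N x + N y) \<and>
     (\<forall>c x. N (c *\<^sub>R x) = \<bar>c\<bar> * N x)"

text \<open>
  The infimum is attained when \<open>S\<close> is closed and nonempty and \<open>N\<close> is a norm on a
  finite-dimensional space.
\<close>

definition dist_to :: "('a::real_vector \<Rightarrow> real) \<Rightarrow> 'a \<Rightarrow> 'a set \<Rightarrow> real" where
  "dist_to N x S = (INF y\<in>S. N (x - y))"

text \<open>Same shape as \<^const>\<open>onorm\<close>; the point \<open>x = 0\<close> contributes \<open>0 / 0 = 0\<close>.\<close>

definition op_norm ::
  "('a::real_vector \<Rightarrow> real) \<Rightarrow> ('b::real_vector \<Rightarrow> real) \<Rightarrow> ('a \<Rightarrow> 'b) \<Rightarrow> real" where
  "op_norm N M B = (SUP x. M (B x) / N x)"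

text \<open>
  Since the set of minimizers is nonempty, the infimum of \<open>F\<close> below is its minimum.
\<close>

definition sharp_around ::
  "('a::real_vector \<Rightarrow> real) \<Rightarrow> real \<Rightarrow> ('a \<Rightarrow> real) \<Rightarrow> 'a set \<Rightarrow> bool" where
  "sharp_around N \<mu> F X \<longleftrightarrow>
     \<mu> > 0 \<and> convex_on UNIV F \<and> X \<noteq> {} \<and> convex X \<and>
     X = {x. is_arg_min F (\<lambda>_. True) x} \<and>
     (\<forall>x. F x - (INF z. F z) \<ge> \<mu> * dist_to N x X)"

definition penalized ::
  "('v::real_vector \<Rightarrow> real) \<Rightarrow> ('w::real_vector \<Rightarrow> real) \<Rightarrow>
   ('v \<Rightarrow> real) \<Rightarrow> ('v \<Rightarrow> 'w) \<Rightarrow> 'w \<Rightarrow> 'v set \<Rightarrow> real \<Rightarrow> real \<Rightarrow> 'v \<Rightarrow> real" where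
  "penalized NV NW f A b K r l x = f x + r * NW (A x - b) + l * dist_to NV x K"

definition sharp_problem ::
  "('v::real_vector \<Rightarrow> real) \<Rightarrow> ('w::real_vector \<Rightarrow> real) \<Rightarrow>
   ('v \<Rightarrow> real) \<Rightarrow> ('v \<Rightarrow> 'w) \<Rightarrow> 'w \<Rightarrow> 'v set \<Rightarrow> real \<Rightarrow> real \<Rightarrow> real \<Rightarrow> 'v \<Rightarrow> bool" where
  "sharp_problem NV NW f A b K \<mu> r l x0 \<longleftrightarrow>
     \<mu> > 0 \<and> r \<ge> 0 \<and> l \<ge> 0 \<and> A x0 = b \<and> x0 \<in> K \<and>
     sharp_around NV \<mu> (penalized NV NW f A b K r l) {x0}"

end

theory Submission
  imports Defs
begin

text \<open>
  For a single point \<open>x\<^sub>0\<close> and a norm \<open>N\<close>, sharpness of a convex function \<open>F\<close> is just linear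
  growth, \<open>F x - F x\<^sub>0 \<ge> \<mu> * N (x - x\<^sub>0)\<close>: that \<open>x\<^sub>0\<close> is the only minimizer then follows from
  definiteness of \<open>N\<close> (lemma \<open>sharp_around_singleton_iff\<close>). The perturbation
  \<open>x \<mapsto> r * M (B x - B x\<^sub>0 - \<delta>)\<close> is convex, and by the triangle inequality it is at most
  \<open>r * M (B (x - x\<^sub>0))\<close> smaller at \<open>x\<close> than at \<open>x\<^sub>0\<close>, hence at most
  \<open>r * op_norm N M B * N (x - x\<^sub>0)\<close> smaller. Adding it therefore costs at most \<open>r * op_norm N M B\<close>
  of the growth rate \<open>\<mu>\<close>.

  The bound \<open>M (B v) \<le> op_norm N M B * N v\<close> carries the analytic content
  (lemma \<open>op_norm_bound\<close>). Since \<open>op_norm\<close> is a real supremum, it bounds the quotients only if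
  they are bounded above, and this is where finite dimension enters: \<open>M \<circ> B\<close> is bounded above
  by a multiple of the Euclidean norm, and \<open>N\<close> is bounded below by a positive multiple of it.
\<close>

context
  fixes N :: "'a::real_vector \<Rightarrow> real"
  assumes norm: "is_norm N"
begin

lemma is_norm_eq_0_iff: "N x = 0 \<longleftrightarrow> x = 0"
  and is_norm_triangle: "N (x + y) \<le> N x + N y"
  and is_norm_scaleR: "N (c *\<^sub>R x) = \<bar>c\<bar> * N x"
  using norm unfolding is_norm_def by blast+

lemma is_norm_zero: "N 0 = 0"
  by (simp add: is_norm_eq_0_iff)

lemma is_norm_minus: "N (- x) = N x"
  using is_norm_scaleR[of "-1" x] by simp

lemma is_norm_nonneg: "N x \<ge> 0"
  using is_norm_triangle[of x "- x"] is_norm_zero is_norm_minus[of x] by simp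

lemma is_norm_pos: "x \<noteq> 0 \<Longrightarrow> N x > 0"
  using is_norm_eq_0_iff[of x] is_norm_nonneg[of x] by simp

lemma is_norm_sum: "N (\<Sum>i\<in>I. g i) \<le> (\<Sum>i\<in>I. N (g i))"
proof (induction I rule: infinite_finite_induct)
  case (insert i I)
  then show ?case using is_norm_triangle[of "g i" "sum g I"] by simp
qed (simp_all add: is_norm_zero)

lemma convex_on_is_norm: "convex_on UNIV N"
proof (rule convex_onI)
  fix t :: real and x y :: 'a
  assume "0 < t" "t < 1"
  then show "N ((1 - t) *\<^sub>R x + t *\<^sub>R y) \<le> (1 - t) * N x + t * N y"
    using is_norm_triangle[of "(1 - t) *\<^sub>R x" "t *\<^sub>R y"] by (simp add: is_norm_scaleR)
qed simp

end

text \<open>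
  A norm is convex, hence continuous in finite dimension, so it attains a minimum on the compact
  Euclidean unit sphere; definiteness makes that minimum positive and homogeneity spreads it to the
  whole space.
\<close>

lemma is_norm_lower_bound:
  fixes N :: "'a::euclidean_space \<Rightarrow> real"
  assumes "is_norm N"
  obtains c where "c > 0" "\<And>x. c * norm x \<le> N x"
proof -
  have "continuous_on (sphere 0 1) N"
    using convex_on_continuous[OF open_UNIV convex_on_is_norm[OF assms]]
    by (rule continuous_on_subset) simp
  moreover have "sphere (0::'a) 1 \<noteq> {}"
    by simp
  ultimately obtain u where u: "u \<in> sphere 0 1" "\<And>y. y \<in> sphere 0 1 \<Longrightarrow> N u \<le> N y"
    using continuous_attains_inf[OF compact_sphere] by metis
  show ?thesis
  proof
    show "N u > 0"
      using u(1) by (intro is_norm_pos[OF assms]) auto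
    fix x
    show "N u * norm x \<le> N x"
    proof (cases "x = 0")
      case False
      then have "N u \<le> N (inverse (norm x) *\<^sub>R x)"
        by (intro u(2)) simp
      then show ?thesis
        using False by (simp add: is_norm_scaleR[OF assms] field_simps)
    qed (simp add: is_norm_nonneg[OF assms])
  qed
qed

lemma is_norm_linear_upper_bound:
  fixes B :: "'a::euclidean_space \<Rightarrow> 'b::real_vector"
  assumes "is_norm M" "linear B"
  shows "M (B x) \<le> (\<Sum>i\<in>Basis. M (B i)) * norm x"
proof -
  have "M (B x) = M (\<Sum>i\<in>Basis. (x \<bullet> i) *\<^sub>R B i)"
    by (metis (no_types, lifting) assms(2) euclidean_representation linear_cmul linear_sum sum.cong)
  also have "\<dots> \<le> (\<Sum>i\<in>Basis. \<bar>x \<bullet> i\<bar> * M (B i))"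
    using is_norm_sum[OF assms(1)] by (simp flip: is_norm_scaleR[OF assms(1)])
  also have "\<dots> \<le> (\<Sum>i\<in>Basis. norm x * M (B i))"
    by (intro sum_mono mult_right_mono Basis_le_norm is_norm_nonneg[OF assms(1)])
  finally show ?thesis
    by (simp add: sum_distrib_left mult.commute)
qed

text \<open>
  The substance is that the supremum defining \<^const>\<open>op_norm\<close> is over a bounded set; the two
  comparisons with the Euclidean norm supply a bound.
\<close>

lemma op_norm_bound:
  fixes B :: "'a::euclidean_space \<Rightarrow> 'b::real_vector"
  assumes "is_norm N" "is_norm M" "linear B"
  shows "M (B x) \<le> op_norm N M B * N x"
proof (cases "x = 0")
  case True
  then show ?thesis
    by (simp add: linear_0[OF assms(3)] is_norm_zero[OF assms(1)] is_norm_zero[OF assms(2)])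
next
  case False
  obtain c where c: "c > 0" "\<And>y. c * norm y \<le> N y"
    using is_norm_lower_bound[OF assms(1)] by blast
  define C where "C = (\<Sum>i\<in>Basis. M (B i))"
  have C: "C \<ge> 0"
    unfolding C_def by (intro sum_nonneg is_norm_nonneg[OF assms(2)])
  have "M (B y) / N y \<le> C / c" for y
  proof (cases "y = 0")
    case False
    have "M (B y) \<le> C * norm y"
      unfolding C_def by (rule is_norm_linear_upper_bound[OF assms(2,3)])
    also have "\<dots> \<le> C * (N y / c)"
      using c C by (intro mult_left_mono) (simp_all add: field_simps)
    finally show ?thesis
      using is_norm_pos[OF assms(1) False] c(1) by (simp add: field_simps)
  next
    case True
    then show ?thesis
      using c(1) C is_norm_zero[OF assms(1)] by simp
  qed
  then have "bdd_above (range (\<lambda>y. M (B y) / N y))"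
    by (intro bdd_aboveI2)
  then have "M (B x) / N x \<le> op_norm N M B"
    unfolding op_norm_def by (intro cSUP_upper) simp_all
  then show ?thesis
    using is_norm_pos[OF assms(1) False] by (simp add: field_simps)
qed

lemma sharp_around_singleton_iff:
  assumes "is_norm N"
  shows "sharp_around N \<mu> F {x0} \<longleftrightarrow>
    \<mu> > 0 \<and> convex_on UNIV F \<and> (\<forall>x. F x - F x0 \<ge> \<mu> * N (x - x0))"
proof -
  have dist: "dist_to N x {x0} = N (x - x0)" for x
    by (simp add: dist_to_def)
  have inf: "(INF z. F z) = F x0" if "\<And>z. F x0 \<le> F z"
    using that by (intro cInf_eq_minimum) auto
  have unique: "{x. is_arg_min F (\<lambda>_. True) x} = {x0}" and min: "\<And>z. F x0 \<le> F z"
    if "\<mu> > 0" and growth: "\<And>x. F x - F x0 \<ge> \<mu> * N (x - x0)"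
  proof -
    have strict: "F x0 < F x" if "x \<noteq> x0" for x
      using growth[of x] mult_pos_pos[OF \<open>\<mu> > 0\<close> is_norm_pos[OF assms, of "x - x0"]] that by simp
    then show "F x0 \<le> F z" for z
      by (cases "z = x0") (auto intro: less_imp_le)
    with strict show "{x. is_arg_min F (\<lambda>_. True) x} = {x0}"
      by (auto simp: is_arg_min_linorder simp flip: not_less)
  qed
  show ?thesis
  proof
    assume sharp: "sharp_around N \<mu> F {x0}"
    then have "is_arg_min F (\<lambda>_. True) x0"
      unfolding sharp_around_def by blast
    then have "(INF z. F z) = F x0"
      by (intro inf) (simp add: is_arg_min_linorder)
    with sharp show "\<mu> > 0 \<and> convex_on UNIV F \<and> (\<forall>x. F x - F x0 \<ge> \<mu> * N (x - x0))"
      by (simp add: sharp_around_def dist)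
  next
    assume "\<mu> > 0 \<and> convex_on UNIV F \<and> (\<forall>x. F x - F x0 \<ge> \<mu> * N (x - x0))"
    then show "sharp_around N \<mu> F {x0}"
      using unique inf[OF min] by (simp add: sharp_around_def dist)
  qed
qed

lemma convex_on_is_norm_affine:
  assumes "is_norm M" "linear B"
  shows "convex_on UNIV (\<lambda>x. M (B x - a))"
proof (rule convex_onI)
  fix t :: real and x y
  assume t: "0 < t" "t < 1"
  have "B ((1 - t) *\<^sub>R x + t *\<^sub>R y) - a = (1 - t) *\<^sub>R (B x - a) + t *\<^sub>R (B y - a)"
    unfolding linear_add[OF assms(2)] linear_cmul[OF assms(2)] by (simp add: algebra_simps)
  then show "M (B ((1 - t) *\<^sub>R x + t *\<^sub>R y) - a) \<le> (1 - t) * M (B x - a) + t * M (B y - a)"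
    using convex_onD[OF convex_on_is_norm[OF assms(1)], of t "B x - a" "B y - a"] t by simp
qed simp

text \<open>
  Moving from \<open>x\<^sub>0\<close> to \<open>x\<close> changes the argument of \<open>M\<close> from \<open>-\<delta>\<close> to \<open>B (x - x\<^sub>0) - \<delta>\<close>, so the
  perturbation decreases by at most \<open>r * M (B (x - x\<^sub>0))\<close>, whatever \<open>\<delta>\<close> is; the growth of \<open>F\<close>
  outweighs this.
\<close>

lemma sharp_around_add_norm:
  fixes B :: "'a::euclidean_space \<Rightarrow> 'b::real_vector"
  assumes N: "is_norm N" and M: "is_norm M" and B: "linear B"
    and sharp: "sharp_around N \<mu> F {x0}" and r: "r \<ge> 0" "r * op_norm N M B < \<mu>"
  shows "sharp_around N (\<mu> - r * op_norm N M B) (\<lambda>x. F x + r * M (B x - B x0 - \<delta>)) {x0}"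
proof -
  have F: "convex_on UNIV F" and growth: "F x - F x0 \<ge> \<mu> * N (x - x0)" for x
    using sharp unfolding sharp_around_singleton_iff[OF N] by blast+
  have "convex_on UNIV (\<lambda>x. F x + r * M (B x - B x0 - \<delta>))"
    using convex_on_is_norm_affine[OF M B, of "B x0 + \<delta>"] F r(1)
    by (intro convex_on_add convex_on_cmul) (simp_all add: diff_diff_eq)
  moreover have "(\<mu> - r * op_norm N M B) * N (x - x0) \<le>
      (F x + r * M (B x - B x0 - \<delta>)) - (F x0 + r * M (B x0 - B x0 - \<delta>))" for x
  proof -
    have "M \<delta> \<le> M (B (x - x0)) + M (B x - B x0 - \<delta>)"
      using is_norm_triangle[OF M, of "B (x - x0)" "- (B x - B x0 - \<delta>)"]
      unfolding is_norm_minus[OF M] by (simp add: linear_diff[OF B])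
    also have "\<dots> \<le> op_norm N M B * N (x - x0) + M (B x - B x0 - \<delta>)"
      using op_norm_bound[OF N M B] by simp
    finally have "r * M \<delta> \<le> r * (op_norm N M B * N (x - x0) + M (B x - B x0 - \<delta>))"
      using r(1) by (rule mult_left_mono)
    then show ?thesis
      using growth[of x] is_norm_minus[OF M, of \<delta>] by (simp add: algebra_simps)
  qed
  ultimately show ?thesis
    unfolding sharp_around_singleton_iff[OF N] using r(2) by simp
qed

theorem proposition3:
  fixes NV :: "'v::euclidean_space \<Rightarrow> real"
    and NW :: "'w::euclidean_space \<Rightarrow> real"
    and NU :: "'u::euclidean_space \<Rightarrow> real"
    and A :: "'v \<Rightarrow> 'w" and B :: "'v \<Rightarrow> 'u"
    and f :: "'v \<Rightarrow> real" and K :: "'v set"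
    and x0 :: 'v and b :: 'w and \<delta> :: 'u
    and \<mu> r l :: real
  assumes "is_norm NV" and "is_norm NW" and "is_norm NU"
    and "linear A" and "convex_on UNIV f"
    and "closed K" and "convex_cone K"
    and "b = A x0"
    and "sharp_problem NV NW f A b K \<mu> r l x0"
    and "linear B"
    and "r * op_norm NV NU B < \<mu>"
  shows "sharp_around NV (\<mu> - r * op_norm NV NU B)
           (\<lambda>x. penalized NV NW f A b K r l x + r * NU (B x - B x0 - \<delta>)) {x0}"
proof -
  from assms(9) have "sharp_around NV \<mu> (penalized NV NW f A b K r l) {x0}" and "r \<ge> 0"
    unfolding sharp_problem_def by blast+
  with assms show ?thesis
    by (intro sharp_around_add_norm)
qed

end
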